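(* Let $\mathit{Atm}_0$ be finite. Then the logic $\mathsf{D\text{-}PLC}$ is sound and complete relative to the class $\mathbf{MCM}$: a formula of $\mathcal{L}^{\mathit{dyn}}$ is a theorem of $\mathsf{D\text{-}PLC}$ if and only if it is valid in every multi-classifier model.
   Context: Let $\mathit{Atm}_0$ be a set of atomic propositions and $\mathit{Val}$ a finite set of output values; decision atoms $\mathsf{t}(x)$ for $x\in\mathit{Val}$. Language $\mathcal{L}^{\mathit{dyn}}$: $\varphi ::= p \mid \mathsf{t}(x)\mid \neg\varphi\mid \varphi\wedge\varphi\mid \Box_{\mathtt{I}}\varphi\mid \Box_{\mathtt{F}}\varphi\mid[\varphi]\psi$ ($p\in\mathit{Atm}_0$, $x\in\mathit{Val}$); $\mathcal{L}$ is its fragment without $[\varphi]\psi$. A multi-classifier model (MCM) is a pair $\Gamma=(S,\Phi)$ with $S\subseteq 2^{\mathit{Atm}_0}$ and $\Phi$ a set of functions from $S$ to $\mathit{Val}$. For $s\in S$, $f\in\Phi$: $(\Gamma,s,f)\models p$ iff $p\in s$; $(\Gamma,s,f)\models\mathsf{t}(x)$ iff $f(s)=x$; Boolean connectives as usual; $(\Gamma,s,f)\models\Box_{\mathtt{I}}\varphi$ iff $(\Gamma,s',f)\models\varphi$ for all $s'\in S$; $(\Gamma,s,f)\models\Box_{\mathtt{F}}\varphi$ iff $(\Gamma,s,f')\models\varphi$ for all $f'\in\Phi$; $(\Gamma,s,f)\models[\varphi]\psi$ iff, if $(\Gamma,s,f)\models\Box_{\mathtt{I}}\varphi$ then $(\Gamma^\varphi,s,f)\models\psi$,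 where $\Gamma^\varphi=(S,\Phi^\varphi)$ with $\Phi^\varphi=\{f'\in\Phi:\forall s'\in S,\ (\Gamma,s',f')\models\varphi\}$. For finite $X,Y\subseteq\mathit{Atm}_0$ let $\mathrm{cn}_{X,Y}=\bigwedge_{p\in X}p\wedge\bigwedge_{p\in Y\setminus X}\neg p$. The logic $\mathsf{PLC}$ is classical propositional logic plus, with $\blacksquare\in\{\Box_{\mathtt{I}},\Box_{\mathtt{F}}\}$: K: $(\blacksquare\varphi\wedge\blacksquare(\varphi\to\psi))\to\blacksquare\psi$; T: $\blacksquare\varphi\to\varphi$; 4: $\blacksquare\varphi\to\blacksquare\blacksquare\varphi$; 5: $\neg\blacksquare\varphi\to\blacksquare\neg\blacksquare\varphi$; Comm: $\Box_{\mathtt{F}}\Box_{\mathtt{I}}\varphi\leftrightarrow\Box_{\mathtt{I}}\Box_{\mathtt{F}}\varphi$; AtLeast: $\bigvee_{x\in\mathit{Val}}\mathsf{t}(x)$; AtMost: $\mathsf{t}(x)\to\neg\mathsf{t}(y)$ for $x\neq y$; Funct: $(\mathrm{cn}_{X,\mathit{Atm}_0}\wedge\mathsf{t}(x))\to\Box_{\mathtt{I}}(\mathrm{cn}_{X,\mathit{Atm}_0}\to\mathsf{t}(x))$ for $X\subseteq\mathit{Atm}_0$; Indep: $p\to\Box_{\mathtt{F}}p$, $\neg p\to\Box_{\mathtt{F}}\neg p$; Nec: from $\varphi$ infer $\blacksquare\varphi$. The logic $\mathsf{D\text{-}PLC}$ extends $\mathsf{PLC}$ (over $\mathcal{L}^{\mathit{dyn}}$)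 by the reduction axioms $[\varphi]p\leftrightarrow(\Box_{\mathtt{I}}\varphi\to p)$; $[\varphi]\mathsf{t}(x)\leftrightarrow(\Box_{\mathtt{I}}\varphi\to\mathsf{t}(x))$; $[\varphi]\neg\psi\leftrightarrow(\Box_{\mathtt{I}}\varphi\to\neg[\varphi]\psi)$; $[\varphi](\psi_1\wedge\psi_2)\leftrightarrow([\varphi]\psi_1\wedge[\varphi]\psi_2)$; $[\varphi]\Box_{\mathtt{I}}\psi\leftrightarrow(\Box_{\mathtt{I}}\varphi\to\Box_{\mathtt{I}}[\varphi]\psi)$; $[\varphi]\Box_{\mathtt{F}}\psi\leftrightarrow(\Box_{\mathtt{I}}\varphi\to\Box_{\mathtt{F}}[\varphi]\psi)$, and the rule of replacement of equivalents: from $\varphi_1\leftrightarrow\varphi_2$ infer $\psi\leftrightarrow\psi[\varphi_1/\varphi_2]$. *)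

theory Defs
  imports Main "HOL-Library.FuncSet"
begin

section \<open>Language\<close>

text \<open>\<open>Ann \<phi> \<psi>\<close> is the dynamic formula \<open>[\<phi>]\<psi>\<close>.\<close>

datatype (atoms: 'a, decs: 'v) fml =
    Atom 'a
  | Dec 'v
  | Neg "('a, 'v) fml"
  | And "('a, 'v) fml" "('a, 'v) fml"
  | BoxI "('a, 'v) fml"
  | BoxF "('a, 'v) fml"
  | Ann "('a, 'v) fml" "('a, 'v) fml"

definition Ldyn :: "'a set \<Rightarrow> 'v set \<Rightarrow> ('a, 'v) fml set" where
  "Ldyn Atm0 Val = {\<phi>. atoms \<phi> \<subseteq> Atm0 \<and> decs \<phi> \<subseteq> Val}"

abbreviation Or :: "('a, 'v) fml \<Rightarrow> ('a, 'v) fml \<Rightarrow> ('a, 'v) fml" where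
  "Or \<phi> \<psi> \<equiv> Neg (And (Neg \<phi>) (Neg \<psi>))"

abbreviation Imp :: "('a, 'v) fml \<Rightarrow> ('a, 'v) fml \<Rightarrow> ('a, 'v) fml" where
  "Imp \<phi> \<psi> \<equiv> Neg (And \<phi> (Neg \<psi>))"

abbreviation Iff :: "('a, 'v) fml \<Rightarrow> ('a, 'v) fml \<Rightarrow> ('a, 'v) fml" where
  "Iff \<phi> \<psi> \<equiv> And (Imp \<phi> \<psi>) (Imp \<psi> \<phi>)"

text \<open>The language has no primitive constants, so the values of the empty conjunction and
  of the empty disjunction are built from an arbitrary formula of the language.\<close>

definition Top :: "'a set \<Rightarrow> 'v set \<Rightarrow> ('a, 'v) fml" where
  "Top Atm0 Val = (let \<phi> = (SOME \<phi>. \<phi> \<in> Ldyn Atm0 Val) in Or \<phi> (Neg \<phi>))"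

text \<open>Conjunctions and disjunctions indexed by a finite set use an arbitrary but fixed
  enumeration of it.\<close>

definition enumeration :: "'b set \<Rightarrow> 'b list" where
  "enumeration A = (SOME xs. distinct xs \<and> set xs = A)"

definition BigAnd :: "'a set \<Rightarrow> 'v set \<Rightarrow> ('b \<Rightarrow> ('a, 'v) fml) \<Rightarrow> 'b set \<Rightarrow> ('a, 'v) fml" where
  "BigAnd Atm0 Val F A = foldr And (map F (enumeration A)) (Top Atm0 Val)"

definition BigOr :: "'a set \<Rightarrow> 'v set \<Rightarrow> ('b \<Rightarrow> ('a, 'v) fml) \<Rightarrow> 'b set \<Rightarrow> ('a, 'v) fml" where
  "BigOr Atm0 Val F A = foldr Or (map F (enumeration A)) (Neg (Top Atm0 Val))"

definition cn :: "'a set \<Rightarrow> 'v set \<Rightarrow> 'a set \<Rightarrow> 'a set \<Rightarrow> ('a, 'v) fml" where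
  "cn Atm0 Val X Y =
     And (BigAnd Atm0 Val Atom X) (BigAnd Atm0 Val (\<lambda>p. Neg (Atom p)) (Y - X))"

section \<open>Multi-classifier models\<close>

text \<open>A function from \<open>S\<close> to \<open>Val\<close> is an element of \<open>S \<rightarrow>\<^sub>E Val\<close>, so that
  it is determined by its values on \<open>S\<close>.\<close>

definition MCM :: "'a set \<Rightarrow> 'v set \<Rightarrow> 'a set set \<Rightarrow> ('a set \<Rightarrow> 'v) set \<Rightarrow> bool" where
  "MCM Atm0 Val S \<Phi> \<longleftrightarrow> S \<subseteq> Pow Atm0 \<and> \<Phi> \<subseteq> (S \<rightarrow>\<^sub>E Val)"

text \<open>In the clause for \<open>Ann \<phi> \<psi>\<close> the antecedent is the truth condition of
  \<open>BoxI \<phi>\<close>, written out for the sake of structural recursion.\<close>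

primrec sat ::
  "'a set set \<Rightarrow> ('a set \<Rightarrow> 'v) set \<Rightarrow> 'a set \<Rightarrow> ('a set \<Rightarrow> 'v) \<Rightarrow> ('a, 'v) fml \<Rightarrow> bool" where
  "sat S \<Phi> s f (Atom p) \<longleftrightarrow> p \<in> s"
| "sat S \<Phi> s f (Dec x) \<longleftrightarrow> f s = x"
| "sat S \<Phi> s f (Neg \<phi>) \<longleftrightarrow> \<not> sat S \<Phi> s f \<phi>"
| "sat S \<Phi> s f (And \<phi> \<psi>) \<longleftrightarrow> sat S \<Phi> s f \<phi> \<and> sat S \<Phi> s f \<psi>"
| "sat S \<Phi> s f (BoxI \<phi>) \<longleftrightarrow> (\<forall>s'\<in>S. sat S \<Phi> s' f \<phi>)"
| "sat S \<Phi> s f (BoxF \<phi>) \<longleftrightarrow> (\<forall>f'\<in>\<Phi>. sat S \<Phi> s f' \<phi>)"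
| "sat S \<Phi> s f (Ann \<phi> \<psi>) \<longleftrightarrow>
     ((\<forall>s'\<in>S. sat S \<Phi> s' f \<phi>) \<longrightarrow>
       sat S {f' \<in> \<Phi>. \<forall>s'\<in>S. sat S \<Phi> s' f' \<phi>} s f \<psi>)"

definition valid :: "'a set \<Rightarrow> 'v set \<Rightarrow> ('a, 'v) fml \<Rightarrow> bool" where
  "valid Atm0 Val \<phi> \<longleftrightarrow>
     (\<forall>S \<Phi>. MCM Atm0 Val S \<Phi> \<longrightarrow> (\<forall>s\<in>S. \<forall>f\<in>\<Phi>. sat S \<Phi> s f \<phi>))"

section \<open>Axiomatics\<close>

text \<open>Classical propositional logic is given by all instances of propositional tautologies
  together with modus ponens. A formula is such an instance iff it is true under every
  assignment of truth values to its subformulas that are not negations or conjunctions.\<close>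

primrec prop_eval :: "(('a, 'v) fml \<Rightarrow> bool) \<Rightarrow> ('a, 'v) fml \<Rightarrow> bool" where
  "prop_eval v (Atom p) \<longleftrightarrow> v (Atom p)"
| "prop_eval v (Dec x) \<longleftrightarrow> v (Dec x)"
| "prop_eval v (Neg \<phi>) \<longleftrightarrow> \<not> prop_eval v \<phi>"
| "prop_eval v (And \<phi> \<psi>) \<longleftrightarrow> prop_eval v \<phi> \<and> prop_eval v \<psi>"
| "prop_eval v (BoxI \<phi>) \<longleftrightarrow> v (BoxI \<phi>)"
| "prop_eval v (BoxF \<phi>) \<longleftrightarrow> v (BoxF \<phi>)"
| "prop_eval v (Ann \<phi> \<psi>) \<longleftrightarrow> v (Ann \<phi> \<psi>)"

definition tautology :: "('a, 'v) fml \<Rightarrow> bool" where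
  "tautology \<phi> \<longleftrightarrow> (\<forall>v. prop_eval v \<phi>)"

inductive PLC_axiom :: "'a set \<Rightarrow> 'v set \<Rightarrow> ('a, 'v) fml \<Rightarrow> bool" for Atm0 Val where
  Taut: "tautology \<phi> \<Longrightarrow> PLC_axiom Atm0 Val \<phi>"
| K: "B \<in> {BoxI, BoxF} \<Longrightarrow>
    PLC_axiom Atm0 Val (Imp (And (B \<phi>) (B (Imp \<phi> \<psi>))) (B \<psi>))"
| T: "B \<in> {BoxI, BoxF} \<Longrightarrow> PLC_axiom Atm0 Val (Imp (B \<phi>) \<phi>)"
| Four: "B \<in> {BoxI, BoxF} \<Longrightarrow> PLC_axiom Atm0 Val (Imp (B \<phi>) (B (B \<phi>)))"
| Five: "B \<in> {BoxI, BoxF} \<Longrightarrow> PLC_axiom Atm0 Val (Imp (Neg (B \<phi>)) (B (Neg (B \<phi>))))"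
| Comm: "PLC_axiom Atm0 Val (Iff (BoxF (BoxI \<phi>)) (BoxI (BoxF \<phi>)))"
| AtLeast: "PLC_axiom Atm0 Val (BigOr Atm0 Val Dec Val)"
| AtMost: "x \<noteq> y \<Longrightarrow> PLC_axiom Atm0 Val (Imp (Dec x) (Neg (Dec y)))"
| Funct: "X \<subseteq> Atm0 \<Longrightarrow>
    PLC_axiom Atm0 Val
      (Imp (And (cn Atm0 Val X Atm0) (Dec x)) (BoxI (Imp (cn Atm0 Val X Atm0) (Dec x))))"
| Indep_pos: "PLC_axiom Atm0 Val (Imp (Atom p) (BoxF (Atom p)))"
| Indep_neg: "PLC_axiom Atm0 Val (Imp (Neg (Atom p)) (BoxF (Neg (Atom p))))"

inductive reduction_axiom :: "('a, 'v) fml \<Rightarrow> bool" where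
  Red_Atom: "reduction_axiom (Iff (Ann \<phi> (Atom p)) (Imp (BoxI \<phi>) (Atom p)))"
| Red_Dec: "reduction_axiom (Iff (Ann \<phi> (Dec x)) (Imp (BoxI \<phi>) (Dec x)))"
| Red_Neg: "reduction_axiom (Iff (Ann \<phi> (Neg \<psi>)) (Imp (BoxI \<phi>) (Neg (Ann \<phi> \<psi>))))"
| Red_And: "reduction_axiom (Iff (Ann \<phi> (And \<psi>1 \<psi>2)) (And (Ann \<phi> \<psi>1) (Ann \<phi> \<psi>2)))"
| Red_BoxI: "reduction_axiom (Iff (Ann \<phi> (BoxI \<psi>)) (Imp (BoxI \<phi>) (BoxI (Ann \<phi> \<psi>))))"
| Red_BoxF: "reduction_axiom (Iff (Ann \<phi> (BoxF \<psi>)) (Imp (BoxI \<phi>) (BoxF (Ann \<phi> \<psi>))))"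

text \<open>\<open>replaces \<phi>1 \<phi>2 \<psi> \<psi>'\<close>: the formula \<open>\<psi>'\<close> results from \<open>\<psi>\<close> by replacing
  zero or more occurrences of \<open>\<phi>1\<close> by \<open>\<phi>2\<close>.\<close>

inductive replaces ::
  "('a, 'v) fml \<Rightarrow> ('a, 'v) fml \<Rightarrow> ('a, 'v) fml \<Rightarrow> ('a, 'v) fml \<Rightarrow> bool" for \<phi>1 \<phi>2 where
  "replaces \<phi>1 \<phi>2 \<phi>1 \<phi>2"
| "replaces \<phi>1 \<phi>2 \<psi> \<psi>"
| "replaces \<phi>1 \<phi>2 \<psi> \<psi>' \<Longrightarrow> replaces \<phi>1 \<phi>2 (Neg \<psi>) (Neg \<psi>')"
| "replaces \<phi>1 \<phi>2 \<psi> \<psi>' \<Longrightarrow> replaces \<phi>1 \<phi>2 \<chi> \<chi>' \<Longrightarrow>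
     replaces \<phi>1 \<phi>2 (And \<psi> \<chi>) (And \<psi>' \<chi>')"
| "replaces \<phi>1 \<phi>2 \<psi> \<psi>' \<Longrightarrow> replaces \<phi>1 \<phi>2 (BoxI \<psi>) (BoxI \<psi>')"
| "replaces \<phi>1 \<phi>2 \<psi> \<psi>' \<Longrightarrow> replaces \<phi>1 \<phi>2 (BoxF \<psi>) (BoxF \<psi>')"
| "replaces \<phi>1 \<phi>2 \<psi> \<psi>' \<Longrightarrow> replaces \<phi>1 \<phi>2 \<chi> \<chi>' \<Longrightarrow>
     replaces \<phi>1 \<phi>2 (Ann \<psi> \<chi>) (Ann \<psi>' \<chi>')"

text \<open>The side conditions on \<open>Ldyn\<close> restrict derivations to formulas over \<open>Atm0\<close> and
  \<open>Val\<close>; the remaining rules preserve this.\<close>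

inductive D_PLC :: "'a set \<Rightarrow> 'v set \<Rightarrow> ('a, 'v) fml \<Rightarrow> bool" for Atm0 Val where
  PLC_ax: "PLC_axiom Atm0 Val \<phi> \<Longrightarrow> \<phi> \<in> Ldyn Atm0 Val \<Longrightarrow> D_PLC Atm0 Val \<phi>"
| Red_ax: "reduction_axiom \<phi> \<Longrightarrow> \<phi> \<in> Ldyn Atm0 Val \<Longrightarrow> D_PLC Atm0 Val \<phi>"
| MP: "D_PLC Atm0 Val (Imp \<phi> \<psi>) \<Longrightarrow> D_PLC Atm0 Val \<phi> \<Longrightarrow> D_PLC Atm0 Val \<psi>"
| Nec: "B \<in> {BoxI, BoxF} \<Longrightarrow> D_PLC Atm0 Val \<phi> \<Longrightarrow> D_PLC Atm0 Val (B \<phi>)"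
| RE: "D_PLC Atm0 Val (Iff \<phi>1 \<phi>2) \<Longrightarrow> \<psi> \<in> Ldyn Atm0 Val \<Longrightarrow> replaces \<phi>1 \<phi>2 \<psi> \<psi>' \<Longrightarrow>
    D_PLC Atm0 Val (Iff \<psi> \<psi>')"

end

theory Submission
  imports Defs
begin

text \<open>Soundness is checked axiom by axiom. For completeness the reduction axioms and the
  replacement rule, applied to innermost announcements, turn every formula into a provably
  equivalent static one. A static non-theorem is refuted in a component of the canonical model:
  a maximal theory \<open>\<Gamma>\<close> is sent to the pair \<open>(s, f)\<close> consisting of its set of atoms \<open>s\<close> and of the
  function \<open>f\<close> that reads off the decision atoms along the \<open>\<box>\<^sub>I\<close>-class of \<open>\<Gamma>\<close>, which is well defined
  by Funct. Comm, together with Indep, makes every state of the component occur in every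
  \<open>\<box>\<^sub>I\<close>-class, so this map is a bounded morphism onto a multi-classifier model.\<close>

section \<open>Soundness\<close>

lemma Ldyn_simps [simp]:
  "Atom p \<in> Ldyn A V \<longleftrightarrow> p \<in> A"
  "Dec x \<in> Ldyn A V \<longleftrightarrow> x \<in> V"
  "Neg \<phi> \<in> Ldyn A V \<longleftrightarrow> \<phi> \<in> Ldyn A V"
  "And \<phi> \<psi> \<in> Ldyn A V \<longleftrightarrow> \<phi> \<in> Ldyn A V \<and> \<psi> \<in> Ldyn A V"
  "BoxI \<phi> \<in> Ldyn A V \<longleftrightarrow> \<phi> \<in> Ldyn A V"
  "BoxF \<phi> \<in> Ldyn A V \<longleftrightarrow> \<phi> \<in> Ldyn A V"
  "Ann \<phi> \<psi> \<in> Ldyn A V \<longleftrightarrow> \<phi> \<in> Ldyn A V \<and> \<psi> \<in> Ldyn A V"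
  by (auto simp: Ldyn_def)

lemma set_enumeration: "finite A \<Longrightarrow> set (enumeration A) = A"
  unfolding enumeration_def by (rule someI2_ex) (use finite_distinct_list in blast)+

lemma sat_Top [simp]: "sat S \<Phi> s f (Top A V)"
  by (simp add: Top_def Let_def)

lemma sat_BigAnd:
  assumes "finite X"
  shows "sat S \<Phi> s f (BigAnd A V F X) \<longleftrightarrow> (\<forall>x\<in>X. sat S \<Phi> s f (F x))"
proof -
  have "sat S \<Phi> s f (foldr And (map F xs) (Top A V)) \<longleftrightarrow> (\<forall>x\<in>set xs. sat S \<Phi> s f (F x))" for xs
    by (induction xs) auto
  then show ?thesis
    by (simp only: BigAnd_def set_enumeration[OF assms])
qed

lemma sat_BigOr:
  assumes "finite X"
  shows "sat S \<Phi> s f (BigOr A V F X) \<longleftrightarrow> (\<exists>x\<in>X. sat S \<Phi> s f (F x))"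
proof -
  have "sat S \<Phi> s f (foldr Or (map F xs) (Neg (Top A V))) \<longleftrightarrow> (\<exists>x\<in>set xs. sat S \<Phi> s f (F x))"
    for xs
    by (induction xs) auto
  then show ?thesis
    by (simp only: BigOr_def set_enumeration[OF assms])
qed

text \<open>Among subsets of \<open>A\<close> this formula describes one state completely. That is
  what lets Funct say that the decision of a function depends on the state alone.\<close>

lemma sat_cn:
  assumes "finite A" "X \<subseteq> A" "s \<subseteq> A"
  shows "sat S \<Phi> s f (cn A V X A) \<longleftrightarrow> s = X"
  using assms finite_subset[OF assms(2,1)] by (auto simp: cn_def sat_BigAnd)

text \<open>Truth at a point is itself one of the valuations over which \<open>tautology\<close>
  quantifies.\<close>

lemma prop_eval_sat: "prop_eval (sat S \<Phi> s f) \<phi> \<longleftrightarrow> sat S \<Phi> s f \<phi>"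
  by (induction \<phi>) auto

lemma tautology_sat: "tautology \<phi> \<Longrightarrow> sat S \<Phi> s f \<phi>"
  using prop_eval_sat unfolding tautology_def by blast

text \<open>The boxes quantify over all of \<open>S\<close> and all of \<open>\<Phi>\<close>, whence
  the S5 axioms and Comm. AtLeast uses that the functions take values in \<open>V\<close>, and Funct
  that all states are subsets of \<open>A\<close>, so that \<open>cn\<close> singles one
  out.\<close>

lemma PLC_axiom_sound:
  assumes "PLC_axiom A V \<phi>" "finite A" "finite V" "MCM A V S \<Phi>" "s \<in> S" "f \<in> \<Phi>"
  shows "sat S \<Phi> s f \<phi>"
  using assms
proof (cases rule: PLC_axiom.cases)
  case Taut
  then show ?thesis by (simp add: tautology_sat)
next
  case AtLeast
  then show ?thesis using assms by (auto simp: sat_BigOr MCM_def)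
next
  case (Funct X x)
  then have "s' \<subseteq> A" if "s' \<in> S" for s'
    using assms(4) that by (auto simp: MCM_def)
  with Funct assms show ?thesis by (auto simp: sat_cn)
qed auto

text \<open>The truth of \<open>BoxI \<phi>\<close> does not depend on the state, which settles the
  \<open>BoxI\<close> axiom. Quantifying over the updated set is quantifying over
  \<open>\<Phi>\<close> under the condition \<open>BoxI \<phi>\<close>, which settles the
  \<open>BoxF\<close> axiom.\<close>

lemma reduction_axiom_sound:
  assumes "reduction_axiom \<phi>"
  shows "sat S \<Phi> s f \<phi>"
  using assms by (cases rule: reduction_axiom.cases) auto

lemma MCM_update: "MCM A V S \<Phi> \<Longrightarrow> MCM A V S {f \<in> \<Phi>. P f}"
  by (auto simp: MCM_def)

text \<open>\<open>\<Phi>\<close> is generalised in the induction because an announcement changes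
  the set of functions. Equivalent announcements cut out the same set.\<close>

lemma replaces_sat:
  assumes "replaces \<phi>1 \<phi>2 \<psi> \<psi>'" "valid A V (Iff \<phi>1 \<phi>2)"
    and "MCM A V S \<Phi>" "s \<in> S" "f \<in> \<Phi>"
  shows "sat S \<Phi> s f \<psi> \<longleftrightarrow> sat S \<Phi> s f \<psi>'"
  using assms(1,3-5)
proof (induction arbitrary: \<Phi> s f rule: replaces.induct)
  case 1
  have "sat S \<Phi> s f (Iff \<phi>1 \<phi>2)"
    using assms(2) 1 unfolding valid_def by blast
  then show ?case by auto
next
  case (7 \<psi> \<psi>' \<chi> \<chi>')
  have eq: "sat S \<Phi> s' f' \<psi> \<longleftrightarrow> sat S \<Phi> s' f' \<psi>'" if "s' \<in> S" "f' \<in> \<Phi>" for s' f'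
    using 7 that by blast
  have upd: "{f' \<in> \<Phi>. \<forall>s'\<in>S. sat S \<Phi> s' f' \<psi>} = {f' \<in> \<Phi>. \<forall>s'\<in>S. sat S \<Phi> s' f' \<psi>'}"
    using eq by blast
  let ?U = "{f' \<in> \<Phi>. \<forall>s'\<in>S. sat S \<Phi> s' f' \<psi>'}"
  \<comment> \<open>The premise of the announcement puts \<open>f\<close> into the updated model,
    where the induction hypothesis for \<open>\<chi>\<close> applies.\<close>
  have "sat S ?U s f \<chi> \<longleftrightarrow> sat S ?U s f \<chi>'" if "f \<in> ?U"
    using 7 that by (intro "7.IH"(2) MCM_update) auto
  then show ?case
    using 7 eq by (simp add: upd)
qed auto

lemma soundness:
  assumes "D_PLC A V \<phi>" "finite A" "finite V"
  shows "valid A V \<phi>"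
  using assms(1)
proof (induction rule: D_PLC.induct)
  case (PLC_ax \<phi>)
  then show ?case
    using PLC_axiom_sound assms by (fastforce simp: valid_def)
next
  case (Red_ax \<phi>)
  then show ?case
    by (auto simp: valid_def reduction_axiom_sound)
next
  case (RE \<phi>1 \<phi>2 \<psi> \<psi>')
  then show ?case
    using replaces_sat[OF RE.hyps(3) RE.IH] by (simp add: valid_def)
qed (auto simp: valid_def)

section \<open>Reduction to static formulas\<close>

primrec static :: "('a, 'v) fml \<Rightarrow> bool" where
  "static (Atom p) \<longleftrightarrow> True"
| "static (Dec x) \<longleftrightarrow> True"
| "static (Neg \<phi>) \<longleftrightarrow> static \<phi>"
| "static (And \<phi> \<psi>) \<longleftrightarrow> static \<phi> \<and> static \<psi>"
| "static (BoxI \<phi>) \<longleftrightarrow> static \<phi>"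
| "static (BoxF \<phi>) \<longleftrightarrow> static \<phi>"
| "static (Ann \<phi> \<psi>) \<longleftrightarrow> False"

lemma replaces_Ldyn:
  "replaces \<phi>1 \<phi>2 \<psi> \<psi>' \<Longrightarrow> \<phi>2 \<in> Ldyn A V \<Longrightarrow> \<psi> \<in> Ldyn A V \<Longrightarrow> \<psi>' \<in> Ldyn A V"
  by (induction rule: replaces.induct) auto

lemma D_PLC_Ldyn: "D_PLC A V \<phi> \<Longrightarrow> \<phi> \<in> Ldyn A V"
proof (induction rule: D_PLC.induct)
  case (RE \<phi>1 \<phi>2 \<psi> \<psi>')
  then show ?case using replaces_Ldyn[OF RE.hyps(3)] by auto
qed auto

lemma D_PLC_taut: "tautology \<phi> \<Longrightarrow> \<phi> \<in> Ldyn A V \<Longrightarrow> D_PLC A V \<phi>"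
  by (intro PLC_ax Taut)

lemma D_PLC_Iff_trans:
  assumes "D_PLC A V (Iff \<phi> \<psi>)" "D_PLC A V (Iff \<psi> \<chi>)"
  shows "D_PLC A V (Iff \<phi> \<chi>)"
proof -
  have "D_PLC A V (Imp (Iff \<phi> \<psi>) (Imp (Iff \<psi> \<chi>) (Iff \<phi> \<chi>)))"
    using assms[THEN D_PLC_Ldyn] by (intro D_PLC_taut) (auto simp: tautology_def)
  then show ?thesis using assms MP by blast
qed

lemma D_PLC_Iff_left:
  assumes "D_PLC A V (Iff \<phi> \<psi>)" "D_PLC A V \<psi>"
  shows "D_PLC A V \<phi>"
proof -
  have "D_PLC A V (Imp (Iff \<phi> \<psi>) (Imp \<psi> \<phi>))"
    using assms[THEN D_PLC_Ldyn] by (intro D_PLC_taut) (auto simp: tautology_def)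
  then show ?thesis using assms MP by blast
qed

lemma D_PLC_Iff_refl: "\<phi> \<in> Ldyn A V \<Longrightarrow> D_PLC A V (Iff \<phi> \<phi>)"
  by (intro D_PLC_taut) (auto simp: tautology_def)

text \<open>The reduction axioms drive the announcement inward until it vanishes at atoms. As
  \<open>\<psi>\<close> is static, no axiom for an announcement directly under an announcement is
  called for.\<close>

lemma Ann_static:
  assumes "static \<psi>" "static \<phi>" "\<psi> \<in> Ldyn A V" "\<phi> \<in> Ldyn A V"
  shows "\<exists>\<chi>. static \<chi> \<and> D_PLC A V (Iff (Ann \<phi> \<psi>) \<chi>)"
  using assms(1,3)
proof (induction \<psi>)
  case (Atom p)
  then have "D_PLC A V (Iff (Ann \<phi> (Atom p)) (Imp (BoxI \<phi>) (Atom p)))"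
    using assms by (intro Red_ax Red_Atom) auto
  then show ?case using assms by (intro exI conjI) auto
next
  case (Dec x)
  then have "D_PLC A V (Iff (Ann \<phi> (Dec x)) (Imp (BoxI \<phi>) (Dec x)))"
    using assms by (intro Red_ax Red_Dec) auto
  then show ?case using assms by (intro exI conjI) auto
next
  case (Neg \<psi>)
  then obtain \<chi> where \<chi>: "static \<chi>" "D_PLC A V (Iff (Ann \<phi> \<psi>) \<chi>)" by auto
  have "D_PLC A V (Iff (Ann \<phi> (Neg \<psi>)) (Imp (BoxI \<phi>) (Neg (Ann \<phi> \<psi>))))"
    using Neg assms by (intro Red_ax Red_Neg) auto
  moreover have "D_PLC A V (Iff (Imp (BoxI \<phi>) (Neg (Ann \<phi> \<psi>))) (Imp (BoxI \<phi>) (Neg \<chi>)))"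
    using Neg assms by (intro RE[OF \<chi>(2)]) (auto intro!: replaces.intros)
  ultimately have "D_PLC A V (Iff (Ann \<phi> (Neg \<psi>)) (Imp (BoxI \<phi>) (Neg \<chi>)))"
    by (rule D_PLC_Iff_trans)
  then show ?case using \<chi> assms by (intro exI conjI) auto
next
  case (And \<psi>1 \<psi>2)
  then obtain \<chi>1 \<chi>2 where \<chi>: "static \<chi>1" "D_PLC A V (Iff (Ann \<phi> \<psi>1) \<chi>1)"
    "static \<chi>2" "D_PLC A V (Iff (Ann \<phi> \<psi>2) \<chi>2)" by auto
  have "D_PLC A V (Iff (Ann \<phi> (And \<psi>1 \<psi>2)) (And (Ann \<phi> \<psi>1) (Ann \<phi> \<psi>2)))"
    using And assms by (intro Red_ax Red_And) auto
  \<comment> \<open>The two conjuncts are replaced one after the other, since each has its own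
    equivalence.\<close>
  moreover have "D_PLC A V (Iff (And (Ann \<phi> \<psi>1) (Ann \<phi> \<psi>2)) (And \<chi>1 (Ann \<phi> \<psi>2)))"
    using And assms by (intro RE[OF \<chi>(2)]) (auto intro: replaces.intros)
  moreover have "D_PLC A V (Iff (And \<chi>1 (Ann \<phi> \<psi>2)) (And \<chi>1 \<chi>2))"
    using And assms D_PLC_Ldyn[OF \<chi>(2)]
    by (intro RE[OF \<chi>(4)]) (auto intro: replaces.intros)
  ultimately have "D_PLC A V (Iff (Ann \<phi> (And \<psi>1 \<psi>2)) (And \<chi>1 \<chi>2))"
    using D_PLC_Iff_trans by blast
  then show ?case using \<chi> by (intro exI conjI) auto
next
  case (BoxI \<psi>)
  then obtain \<chi> where \<chi>: "static \<chi>" "D_PLC A V (Iff (Ann \<phi> \<psi>) \<chi>)" by auto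
  have "D_PLC A V (Iff (Ann \<phi> (BoxI \<psi>)) (Imp (BoxI \<phi>) (BoxI (Ann \<phi> \<psi>))))"
    using BoxI assms by (intro Red_ax Red_BoxI) auto
  moreover have "D_PLC A V (Iff (Imp (BoxI \<phi>) (BoxI (Ann \<phi> \<psi>))) (Imp (BoxI \<phi>) (BoxI \<chi>)))"
    using BoxI assms by (intro RE[OF \<chi>(2)]) (auto intro!: replaces.intros)
  ultimately have "D_PLC A V (Iff (Ann \<phi> (BoxI \<psi>)) (Imp (BoxI \<phi>) (BoxI \<chi>)))"
    by (rule D_PLC_Iff_trans)
  then show ?case using \<chi> assms by (intro exI conjI) auto
next
  case (BoxF \<psi>)
  then obtain \<chi> where \<chi>: "static \<chi>" "D_PLC A V (Iff (Ann \<phi> \<psi>) \<chi>)" by auto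
  have "D_PLC A V (Iff (Ann \<phi> (BoxF \<psi>)) (Imp (BoxI \<phi>) (BoxF (Ann \<phi> \<psi>))))"
    using BoxF assms by (intro Red_ax Red_BoxF) auto
  moreover have "D_PLC A V (Iff (Imp (BoxI \<phi>) (BoxF (Ann \<phi> \<psi>))) (Imp (BoxI \<phi>) (BoxF \<chi>)))"
    using BoxF assms by (intro RE[OF \<chi>(2)]) (auto intro!: replaces.intros)
  ultimately have "D_PLC A V (Iff (Ann \<phi> (BoxF \<psi>)) (Imp (BoxI \<phi>) (BoxF \<chi>)))"
    by (rule D_PLC_Iff_trans)
  then show ?case using \<chi> assms by (intro exI conjI) auto
qed auto

text \<open>Announcements are removed innermost first: both arguments are made static before
  \<open>Ann_static\<close> is applied.\<close>

lemma static_equivalent: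
  assumes "\<phi> \<in> Ldyn A V"
  shows "\<exists>\<chi>. static \<chi> \<and> D_PLC A V (Iff \<phi> \<chi>)"
  using assms
proof (induction \<phi>)
  case (Atom p)
  then show ?case by (intro exI[of _ "Atom p"] conjI D_PLC_Iff_refl) auto
next
  case (Dec x)
  then show ?case by (intro exI[of _ "Dec x"] conjI D_PLC_Iff_refl) auto
next
  case (Neg \<phi>)
  then obtain \<chi> where \<chi>: "static \<chi>" "D_PLC A V (Iff \<phi> \<chi>)" by auto
  have "D_PLC A V (Iff (Neg \<phi>) (Neg \<chi>))"
    using Neg by (intro RE[OF \<chi>(2)]) (auto intro: replaces.intros)
  then show ?case using \<chi> by (intro exI conjI) auto
next
  case (And \<phi>1 \<phi>2)
  then obtain \<chi>1 \<chi>2 where \<chi>: "static \<chi>1" "D_PLC A V (Iff \<phi>1 \<chi>1)"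
    "static \<chi>2" "D_PLC A V (Iff \<phi>2 \<chi>2)" by auto
  have "D_PLC A V (Iff (And \<phi>1 \<phi>2) (And \<chi>1 \<phi>2))"
    using And by (intro RE[OF \<chi>(2)]) (auto intro: replaces.intros)
  moreover have "D_PLC A V (Iff (And \<chi>1 \<phi>2) (And \<chi>1 \<chi>2))"
    using And D_PLC_Ldyn[OF \<chi>(2)] by (intro RE[OF \<chi>(4)]) (auto intro: replaces.intros)
  ultimately have "D_PLC A V (Iff (And \<phi>1 \<phi>2) (And \<chi>1 \<chi>2))"
    by (rule D_PLC_Iff_trans)
  then show ?case using \<chi> by (intro exI conjI) auto
next
  case (BoxI \<phi>)
  then obtain \<chi> where \<chi>: "static \<chi>" "D_PLC A V (Iff \<phi> \<chi>)" by auto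
  have "D_PLC A V (Iff (BoxI \<phi>) (BoxI \<chi>))"
    using BoxI by (intro RE[OF \<chi>(2)]) (auto intro: replaces.intros)
  then show ?case using \<chi> by (intro exI conjI) auto
next
  case (BoxF \<phi>)
  then obtain \<chi> where \<chi>: "static \<chi>" "D_PLC A V (Iff \<phi> \<chi>)" by auto
  have "D_PLC A V (Iff (BoxF \<phi>) (BoxF \<chi>))"
    using BoxF by (intro RE[OF \<chi>(2)]) (auto intro: replaces.intros)
  then show ?case using \<chi> by (intro exI conjI) auto
next
  case (Ann \<phi>1 \<phi>2)
  then obtain \<chi>1 \<chi>2 where \<chi>: "static \<chi>1" "D_PLC A V (Iff \<phi>1 \<chi>1)"
    "static \<chi>2" "D_PLC A V (Iff \<phi>2 \<chi>2)" by auto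
  have L: "\<chi>1 \<in> Ldyn A V" "\<chi>2 \<in> Ldyn A V"
    using D_PLC_Ldyn[OF \<chi>(2)] D_PLC_Ldyn[OF \<chi>(4)] by auto
  obtain \<chi> where \<chi>': "static \<chi>" "D_PLC A V (Iff (Ann \<chi>1 \<chi>2) \<chi>)"
    using Ann_static[OF \<chi>(3,1) L(2,1)] by blast
  \<comment> \<open>Replacement also acts inside the announced formula, which no reduction axiom
    rewrites.\<close>
  have "D_PLC A V (Iff (Ann \<phi>1 \<phi>2) (Ann \<chi>1 \<phi>2))"
    using Ann by (intro RE[OF \<chi>(2)]) (auto intro: replaces.intros)
  moreover have "D_PLC A V (Iff (Ann \<chi>1 \<phi>2) (Ann \<chi>1 \<chi>2))"
    using Ann L by (intro RE[OF \<chi>(4)]) (auto intro: replaces.intros)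
  ultimately have "D_PLC A V (Iff (Ann \<phi>1 \<phi>2) \<chi>)"
    using \<chi>'(2) D_PLC_Iff_trans by blast
  then show ?case using \<chi>' by blast
qed

section \<open>The canonical model\<close>

text \<open>A nonempty language makes the choice in \<open>Top\<close> land in it, so that empty
  conjunctions and disjunctions are formulas of it.\<close>

locale language =
  fixes A :: "'a set" and V :: "'v set"
  assumes finite_A: "finite A" and finite_V: "finite V" and Ldyn_nonempty: "Ldyn A V \<noteq> {}"
begin

abbreviation L :: "('a, 'v) fml set" where
  "L \<equiv> Ldyn A V"

lemma Top_L: "Top A V \<in> L"
  using some_in_eq[of L] Ldyn_nonempty by (simp add: Top_def Let_def)

lemma BigAnd_L:
  assumes "finite X" "\<And>x. x \<in> X \<Longrightarrow> F x \<in> L"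
  shows "BigAnd A V F X \<in> L"
proof -
  have "foldr And (map F xs) (Top A V) \<in> L" if "set xs \<subseteq> X" for xs
    using that assms(2) Top_L by (induction xs) auto
  then show ?thesis
    using set_enumeration[OF assms(1)] by (simp add: BigAnd_def)
qed

lemma BigOr_L:
  assumes "finite X" "\<And>x. x \<in> X \<Longrightarrow> F x \<in> L"
  shows "BigOr A V F X \<in> L"
proof -
  have "foldr Or (map F xs) (Neg (Top A V)) \<in> L" if "set xs \<subseteq> X" for xs
    using that assms(2) Top_L by (induction xs) auto
  then show ?thesis
    using set_enumeration[OF assms(1)] by (simp add: BigOr_def)
qed

lemma cn_L: "X \<subseteq> A \<Longrightarrow> cn A V X A \<in> L"
  using finite_A finite_subset[of X A] by (auto simp: cn_def intro!: BigAnd_L)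

section \<open>Deductive sets and Lindenbaum's lemma\<close>

definition deductive :: "('a, 'v) fml set \<Rightarrow> bool" where
  "deductive T \<longleftrightarrow> T \<subseteq> L \<and> (\<forall>\<phi>. D_PLC A V \<phi> \<longrightarrow> \<phi> \<in> T) \<and>
     (\<forall>\<phi> \<psi>. Imp \<phi> \<psi> \<in> T \<longrightarrow> \<phi> \<in> T \<longrightarrow> \<psi> \<in> T)"

definition maximal :: "('a, 'v) fml set \<Rightarrow> bool" where
  "maximal M \<longleftrightarrow> deductive M \<and> (\<forall>\<phi>\<in>L. Neg \<phi> \<in> M \<longleftrightarrow> \<phi> \<notin> M)"

lemma deductive_L: "deductive T \<Longrightarrow> \<phi> \<in> T \<Longrightarrow> \<phi> \<in> L"
  unfolding deductive_def by blast

lemma deductive_thm: "deductive T \<Longrightarrow> D_PLC A V \<phi> \<Longrightarrow> \<phi> \<in> T"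
  unfolding deductive_def by blast

lemma deductive_MP: "deductive T \<Longrightarrow> Imp \<phi> \<psi> \<in> T \<Longrightarrow> \<phi> \<in> T \<Longrightarrow> \<psi> \<in> T"
  unfolding deductive_def by blast

text \<open>Propositional reasoning inside a deductive set is reduced to a check over all
  valuations.\<close>

lemma deductive_taut1:
  assumes "deductive T" "\<phi> \<in> T" "\<And>v. prop_eval v \<phi> \<Longrightarrow> prop_eval v \<psi>" "\<psi> \<in> L"
  shows "\<psi> \<in> T"
proof -
  have "D_PLC A V (Imp \<phi> \<psi>)"
    using assms(3,4) deductive_L[OF assms(1,2)]
    by (intro D_PLC_taut) (auto simp: tautology_def)
  then show ?thesis
    using deductive_MP[OF assms(1) deductive_thm[OF assms(1)] assms(2)] by blast
qed

lemma deductive_taut2: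
  assumes "deductive T" "\<phi> \<in> T" "\<psi> \<in> T"
    and "\<And>v. prop_eval v \<phi> \<Longrightarrow> prop_eval v \<psi> \<Longrightarrow> prop_eval v \<chi>" "\<chi> \<in> L"
  shows "\<chi> \<in> T"
proof -
  have "Imp \<psi> \<chi> \<in> T"
    by (rule deductive_taut1[OF assms(1,2)]) (use assms deductive_L[OF assms(1,3)] in auto)
  then show ?thesis using deductive_MP[OF assms(1) _ assms(3)] by blast
qed

text \<open>A deduction theorem in disguise: the set collects what \<open>T\<close> yields from the
  extra premise \<open>\<chi>\<close>, with no notion of derivation from premises involved.\<close>

lemma deductive_relative:
  assumes T: "deductive T" and \<chi>: "\<chi> \<in> L"
  shows "deductive {\<psi>. Imp \<chi> \<psi> \<in> T}"
  unfolding deductive_def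
proof (intro conjI allI impI)
  show "{\<psi>. Imp \<chi> \<psi> \<in> T} \<subseteq> L"
    by (auto dest: deductive_L[OF T])
next
  fix \<phi> assume "D_PLC A V \<phi>"
  then have \<phi>: "\<phi> \<in> T" "\<phi> \<in> L" using deductive_thm[OF T] D_PLC_Ldyn by auto
  have "Imp \<chi> \<phi> \<in> T"
    by (rule deductive_taut1[OF T \<phi>(1)]) (use \<phi> \<chi> in auto)
  then show "\<phi> \<in> {\<psi>. Imp \<chi> \<psi> \<in> T}" by simp
next
  fix \<phi> \<psi> assume *: "Imp \<phi> \<psi> \<in> {\<psi>. Imp \<chi> \<psi> \<in> T}" "\<phi> \<in> {\<psi>. Imp \<chi> \<psi> \<in> T}"
  then have \<psi>: "\<psi> \<in> L" by (auto dest!: deductive_L[OF T])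
  have "Imp \<chi> \<psi> \<in> T"
    by (rule deductive_taut2[OF T, of "Imp \<chi> (Imp \<phi> \<psi>)" "Imp \<chi> \<phi>"]) (use * \<psi> \<chi> in auto)
  then show "\<psi> \<in> {\<psi>. Imp \<chi> \<psi> \<in> T}" by simp
qed

text \<open>Zorn's lemma gives a largest \<open>M\<close> among the deductive extensions of
  \<open>T\<close> that omit \<open>\<phi>\<close>. Being largest with this property forces
  \<open>M\<close> to decide every formula.\<close>

lemma lindenbaum:
  assumes T: "deductive T" "\<phi> \<notin> T" and \<phi>: "\<phi> \<in> L"
  shows "\<exists>M. maximal M \<and> T \<subseteq> M \<and> \<phi> \<notin> M"
proof -
  let ?\<A> = "{M. deductive M \<and> T \<subseteq> M \<and> \<phi> \<notin> M}"
  have "\<exists>M\<in>?\<A>. \<forall>X\<in>?\<A>. M \<subseteq> X \<longrightarrow> X = M"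
  proof (rule subset_Zorn_nonempty)
    show "?\<A> \<noteq> {}" using T by blast
  next
    fix \<C> assume ne: "\<C> \<noteq> {}" and ch: "subset.chain ?\<A> \<C>"
    have sub: "\<C> \<subseteq> ?\<A>" and lin: "\<And>X Y. X \<in> \<C> \<Longrightarrow> Y \<in> \<C> \<Longrightarrow> X \<subseteq> Y \<or> Y \<subseteq> X"
      using ch by (auto simp: subset_chain_def)
    have "\<psi> \<in> \<Union>\<C>" if \<chi>: "Imp \<chi> \<psi> \<in> \<Union>\<C>" "\<chi> \<in> \<Union>\<C>" for \<chi> \<psi>
    proof -
      obtain X Y where XY: "X \<in> \<C>" "Imp \<chi> \<psi> \<in> X" "Y \<in> \<C>" "\<chi> \<in> Y"
        using \<chi> by blast
      then obtain Z where Z: "Z \<in> \<C>" "Imp \<chi> \<psi> \<in> Z" "\<chi> \<in> Z"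
        using lin[OF XY(1,3)] by blast
      then have "deductive Z" using sub by blast
      then have "\<psi> \<in> Z" using deductive_MP Z by blast
      then show ?thesis using Z(1) by blast
    qed
    moreover have "\<Union>\<C> \<subseteq> L" using sub deductive_L by blast
    moreover have "\<psi> \<in> \<Union>\<C>" if "D_PLC A V \<psi>" for \<psi>
      using ne sub deductive_thm[OF _ that] by blast
    ultimately have "deductive (\<Union>\<C>)" unfolding deductive_def by simp
    then show "\<Union>\<C> \<in> ?\<A>" using ne sub by blast
  qed
  then obtain M where M: "deductive M" "T \<subseteq> M" "\<phi> \<notin> M"
    and max: "\<And>X. deductive X \<Longrightarrow> M \<subseteq> X \<Longrightarrow> \<phi> \<notin> X \<Longrightarrow> X = M"
    by (smt (verit) mem_Collect_eq order_trans)
  \<comment> \<open>Otherwise \<open>deductive_relative\<close> would give an extension of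
    \<open>M\<close> by \<open>\<chi>\<close> that still omits \<open>\<phi>\<close>, against
    maximality.\<close>
  have imp: "Imp \<chi> \<phi> \<in> M" if "\<chi> \<in> L" "\<chi> \<notin> M" for \<chi>
  proof (rule ccontr)
    assume "Imp \<chi> \<phi> \<notin> M"
    moreover have "M \<subseteq> {\<psi>. Imp \<chi> \<psi> \<in> M}"
    proof
      fix \<psi> assume \<psi>: "\<psi> \<in> M"
      have "Imp \<chi> \<psi> \<in> M"
        by (rule deductive_taut1[OF M(1) \<psi>]) (use that deductive_L[OF M(1) \<psi>] in auto)
      then show "\<psi> \<in> {\<psi>. Imp \<chi> \<psi> \<in> M}" by simp
    qed
    ultimately have "{\<psi>. Imp \<chi> \<psi> \<in> M} = M"
      using deductive_relative[OF M(1) that(1)] max by blast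
    moreover have "Imp \<chi> \<chi> \<in> M"
      using that by (intro deductive_thm[OF M(1)] D_PLC_taut) (auto simp: tautology_def)
    ultimately show False using that by blast
  qed
  have "Neg \<chi> \<in> M \<longleftrightarrow> \<chi> \<notin> M" if \<chi>: "\<chi> \<in> L" for \<chi>
  proof
    assume "Neg \<chi> \<in> M"
    then show "\<chi> \<notin> M"
      using deductive_taut2[OF M(1), of "Neg \<chi>" \<chi> \<phi>] M(3) \<phi> by auto
  next
    assume "\<chi> \<notin> M"
    show "Neg \<chi> \<in> M"
    proof (rule ccontr)
      assume "Neg \<chi> \<notin> M"
      \<comment> \<open>Neither formula being in \<open>M\<close>, each of them implies
        \<open>\<phi>\<close> there, and \<open>\<phi>\<close> follows by cases.\<close>
      then have "Imp (Neg \<chi>) \<phi> \<in> M" "Imp \<chi> \<phi> \<in> M" using imp \<chi> \<open>\<chi> \<notin> M\<close> by auto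
      then have "\<phi> \<in> M" by (rule deductive_taut2[OF M(1)]) (use \<phi> in auto)
      with M(3) show False ..
    qed
  qed
  then show ?thesis using M unfolding maximal_def by blast
qed

section \<open>Maximal sets and the connectives\<close>

lemma maximal_deductive: "maximal M \<Longrightarrow> deductive M"
  by (simp add: maximal_def)

lemma maximal_Neg: "maximal M \<Longrightarrow> \<phi> \<in> L \<Longrightarrow> Neg \<phi> \<in> M \<longleftrightarrow> \<phi> \<notin> M"
  by (simp add: maximal_def)

lemma maximal_And:
  assumes "maximal M"
  shows "And \<phi> \<psi> \<in> M \<longleftrightarrow> \<phi> \<in> M \<and> \<psi> \<in> M"
proof -
  have d: "deductive M" using assms by (rule maximal_deductive)
  show ?thesis
  proof
    assume *: "And \<phi> \<psi> \<in> M"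
    show "\<phi> \<in> M \<and> \<psi> \<in> M"
      using deductive_L[OF d *] by (auto intro!: deductive_taut1[OF d *])
  next
    assume *: "\<phi> \<in> M \<and> \<psi> \<in> M"
    then have "\<phi> \<in> L" "\<psi> \<in> L" using deductive_L[OF d] by blast+
    with * show "And \<phi> \<psi> \<in> M"
      using deductive_taut2[OF d, of \<phi> \<psi> "And \<phi> \<psi>"] by simp
  qed
qed

lemma maximal_rule: "maximal M \<Longrightarrow> D_PLC A V (Imp \<phi> \<psi>) \<Longrightarrow> \<phi> \<in> M \<Longrightarrow> \<psi> \<in> M"
  by (rule deductive_MP[OF maximal_deductive deductive_thm[OF maximal_deductive]])

lemma maximal_Top: "maximal M \<Longrightarrow> Top A V \<in> M"
  by (rule deductive_thm[OF maximal_deductive D_PLC_taut[OF _ Top_L]])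
    (auto simp: tautology_def Top_def Let_def)

lemma maximal_BigAnd:
  assumes "maximal M" "finite X"
  shows "BigAnd A V F X \<in> M \<longleftrightarrow> (\<forall>x\<in>X. F x \<in> M)"
proof -
  have "foldr And (map F xs) (Top A V) \<in> M \<longleftrightarrow> (\<forall>x\<in>set xs. F x \<in> M)" for xs
    using assms(1) by (induction xs) (auto simp: maximal_Top maximal_And)
  then show ?thesis
    by (simp only: BigAnd_def set_enumeration[OF assms(2)])
qed

lemma maximal_BigOr:
  assumes "maximal M" "finite X" and F: "\<And>x. x \<in> X \<Longrightarrow> F x \<in> L"
  shows "BigOr A V F X \<in> M \<longleftrightarrow> (\<exists>x\<in>X. F x \<in> M)"
proof -
  \<comment> \<open>Membership in \<open>L\<close> is carried along because
    \<open>maximal_Neg\<close> asks for it.\<close>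
  have "foldr Or (map F xs) (Neg (Top A V)) \<in> L \<and>
      (foldr Or (map F xs) (Neg (Top A V)) \<in> M \<longleftrightarrow> (\<exists>x\<in>set xs. F x \<in> M))" if "set xs \<subseteq> X" for xs
    using that assms(1) F Top_L
    by (induction xs) (auto simp: maximal_Top maximal_And maximal_Neg)
  then show ?thesis
    using set_enumeration[OF assms(2)] by (simp add: BigOr_def)
qed

section \<open>States and accessibility of maximal sets\<close>

definition state :: "('a, 'v) fml set \<Rightarrow> 'a set" where
  "state M = {p \<in> A. Atom p \<in> M}"

lemma maximal_cn:
  assumes "maximal M" "X \<subseteq> A"
  shows "cn A V X A \<in> M \<longleftrightarrow> state M = X"
  using assms finite_A finite_subset[OF assms(2) finite_A]
  by (auto simp: cn_def maximal_And maximal_BigAnd maximal_Neg state_def)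

text \<open>An equivalence relation by its form. For maximal sets and the two boxes it agrees with
  the usual canonical relation, inclusion of \<open>{\<psi>. B \<psi> \<in> \<Gamma>}\<close> in
  \<open>\<Delta>\<close>, as \<open>accI\<close> and \<open>accD\<close> show.\<close>

definition acc :: "(('a, 'v) fml \<Rightarrow> ('a, 'v) fml) \<Rightarrow> ('a, 'v) fml set \<Rightarrow> ('a, 'v) fml set \<Rightarrow> bool"
  where "acc B \<Gamma> \<Delta> \<longleftrightarrow> (\<forall>\<phi>. B \<phi> \<in> \<Gamma> \<longleftrightarrow> B \<phi> \<in> \<Delta>)"

lemma acc_refl: "acc B \<Gamma> \<Gamma>"
  and acc_sym: "acc B \<Gamma> \<Delta> \<Longrightarrow> acc B \<Delta> \<Gamma>"
  and acc_trans: "acc B \<Gamma> \<Delta> \<Longrightarrow> acc B \<Delta> \<Theta> \<Longrightarrow> acc B \<Gamma> \<Theta>"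
  by (auto simp: acc_def)

text \<open>Theorems enter by Nec, and closure under modus ponens is K.\<close>

lemma deductive_box:
  assumes T: "deductive T" and B: "B \<in> {BoxI, BoxF}"
  shows "deductive {\<psi>. B \<psi> \<in> T}"
  unfolding deductive_def
proof (intro conjI allI impI)
  show "{\<psi>. B \<psi> \<in> T} \<subseteq> L"
    using B by (auto dest: deductive_L[OF T])
next
  fix \<phi> assume "D_PLC A V \<phi>"
  then show "\<phi> \<in> {\<psi>. B \<psi> \<in> T}" using deductive_thm[OF T] Nec[OF B] by simp
next
  fix \<phi> \<psi> assume *: "Imp \<phi> \<psi> \<in> {\<psi>. B \<psi> \<in> T}" "\<phi> \<in> {\<psi>. B \<psi> \<in> T}"
  then have l: "B \<phi> \<in> L" "B (Imp \<phi> \<psi>) \<in> L" by (auto dest: deductive_L[OF T])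
  have "And (B \<phi>) (B (Imp \<phi> \<psi>)) \<in> T"
    by (rule deductive_taut2[OF T, of "B \<phi>" "B (Imp \<phi> \<psi>)"]) (use * l in auto)
  moreover have "D_PLC A V (Imp (And (B \<phi>) (B (Imp \<phi> \<psi>))) (B \<psi>))"
    using l B by (intro PLC_ax K) auto
  ultimately show "\<psi> \<in> {\<psi>. B \<psi> \<in> T}"
    using deductive_thm[OF T] deductive_MP[OF T] by blast
qed

text \<open>Four carries boxes from \<open>\<Gamma>\<close> to \<open>\<Delta>\<close>. Five carries
  negated boxes, and thereby brings boxes back.\<close>

lemma accI:
  assumes M: "maximal \<Gamma>" "maximal \<Delta>" and B: "B \<in> {BoxI, BoxF}"
    and sub: "{\<psi>. B \<psi> \<in> \<Gamma>} \<subseteq> \<Delta>"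
  shows "acc B \<Gamma> \<Delta>"
  unfolding acc_def
proof (intro allI iffI)
  fix \<phi> assume *: "B \<phi> \<in> \<Gamma>"
  then have "D_PLC A V (Imp (B \<phi>) (B (B \<phi>)))"
    using B deductive_L[OF maximal_deductive[OF M(1)] *] by (intro PLC_ax Four) auto
  then show "B \<phi> \<in> \<Delta>" using maximal_rule M(1) * sub by blast
next
  fix \<phi> assume *: "B \<phi> \<in> \<Delta>"
  have l: "B \<phi> \<in> L" using deductive_L[OF maximal_deductive[OF M(2)] *] .
  then have "D_PLC A V (Imp (Neg (B \<phi>)) (B (Neg (B \<phi>))))"
    using B by (intro PLC_ax Five) auto
  then show "B \<phi> \<in> \<Gamma>"
    using maximal_rule[OF M(1)] * sub l maximal_Neg[OF M(1) l] maximal_Neg[OF M(2) l] by blast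
qed

lemma accD:
  assumes "maximal \<Gamma>" "maximal \<Delta>" "B \<in> {BoxI, BoxF}" "acc B \<Gamma> \<Delta>" "B \<phi> \<in> \<Gamma>"
  shows "\<phi> \<in> \<Delta>"
proof -
  have *: "B \<phi> \<in> \<Delta>" using assms by (simp add: acc_def)
  then have "D_PLC A V (Imp (B \<phi>) \<phi>)"
    using deductive_L[OF maximal_deductive[OF assms(2)] *] assms(3) by (intro PLC_ax T) auto
  then show ?thesis using maximal_rule assms(2) * by blast
qed

text \<open>The formulas boxed in \<open>\<Gamma>\<close> form a deductive set without
  \<open>\<phi>\<close>, so Lindenbaum's lemma supplies the witness.\<close>

lemma acc_witness:
  assumes "maximal \<Gamma>" "B \<in> {BoxI, BoxF}" "\<phi> \<in> L" "B \<phi> \<notin> \<Gamma>"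
  shows "\<exists>\<Delta>. maximal \<Delta> \<and> acc B \<Gamma> \<Delta> \<and> \<phi> \<notin> \<Delta>"
  using lindenbaum[OF deductive_box[OF maximal_deductive[OF assms(1)] assms(2)], of \<phi>] assms accI
  by blast

lemma maximal_box:
  assumes "maximal \<Gamma>" "B \<in> {BoxI, BoxF}" "\<phi> \<in> L"
  shows "B \<phi> \<in> \<Gamma> \<longleftrightarrow> (\<forall>\<Delta>. maximal \<Delta> \<longrightarrow> acc B \<Gamma> \<Delta> \<longrightarrow> \<phi> \<in> \<Delta>)"
  using acc_witness[OF assms] accD assms by blast

text \<open>This fills in the fourth corner of the square given by Comm. The desired
  \<open>\<Delta>\<close> must contain everything under \<open>BoxI\<close> in
  \<open>\<Delta>'\<close> and everything under \<open>BoxF\<close> in \<open>\<Gamma>\<close>, and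
  it exists once these demands are jointly consistent.\<close>

lemma acc_commute:
  assumes M: "maximal \<Gamma>" "maximal \<Gamma>'" "maximal \<Delta>'"
    and acc: "acc BoxI \<Gamma> \<Gamma>'" "acc BoxF \<Gamma>' \<Delta>'"
  shows "\<exists>\<Delta>. maximal \<Delta> \<and> acc BoxF \<Gamma> \<Delta> \<and> acc BoxI \<Delta> \<Delta>'"
proof -
  define I where "I = {\<psi>. BoxI \<psi> \<in> \<Delta>'}"
  define F where "F = {\<psi>. BoxF \<psi> \<in> \<Gamma>}"
  have dI: "deductive I" and dF: "deductive F"
    unfolding I_def F_def
    using deductive_box[OF maximal_deductive[OF M(3)], of BoxI]
      deductive_box[OF maximal_deductive[OF M(1)], of BoxF] by simp_all
  txt \<open>The deductive set generated by \<open>I \<union> F\<close>; it is proper by Comm.\<close>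
  define U where "U = {\<psi>. \<exists>\<chi>\<in>I. Imp \<chi> \<psi> \<in> F}"
  have dU: "deductive U"
    unfolding deductive_def
  proof (intro conjI allI impI)
    show "U \<subseteq> L" by (auto simp: U_def dest: deductive_L[OF dF])
  next
    fix \<phi> assume *: "D_PLC A V \<phi>"
    then have "Imp \<phi> \<phi> \<in> F"
      using D_PLC_Ldyn by (intro deductive_thm[OF dF] D_PLC_taut) (auto simp: tautology_def)
    then show "\<phi> \<in> U" using * deductive_thm[OF dI] unfolding U_def by blast
  next
    fix \<phi> \<psi> assume "Imp \<phi> \<psi> \<in> U" "\<phi> \<in> U"
    then obtain \<chi>1 \<chi>2 where \<chi>: "\<chi>1 \<in> I" "\<chi>2 \<in> I" "Imp \<chi>1 (Imp \<phi> \<psi>) \<in> F" "Imp \<chi>2 \<phi> \<in> F"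
      unfolding U_def by blast
    have l: "\<chi>1 \<in> L" "\<chi>2 \<in> L" "\<psi> \<in> L"
      using deductive_L[OF dF \<chi>(3)] deductive_L[OF dF \<chi>(4)] by auto
    \<comment> \<open>Closure of \<open>I\<close> under conjunction is why a single premise from
      \<open>I\<close> suffices in \<open>U\<close>.\<close>
    have "And \<chi>1 \<chi>2 \<in> I"
      by (rule deductive_taut2[OF dI \<chi>(1,2)]) (use l in auto)
    moreover have "Imp (And \<chi>1 \<chi>2) \<psi> \<in> F"
      by (rule deductive_taut2[OF dF \<chi>(3,4)]) (use l in auto)
    ultimately show "\<psi> \<in> U" unfolding U_def by blast
  qed
  \<comment> \<open>The language has no constant for falsity; a contradiction built from any formula
    takes its place.\<close>
  obtain \<theta> where \<theta>: "\<theta> \<in> L" using Ldyn_nonempty by blast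
  have "And \<theta> (Neg \<theta>) \<notin> U"
  proof
    assume "And \<theta> (Neg \<theta>) \<in> U"
    then obtain \<chi> where \<chi>: "\<chi> \<in> I" "Imp \<chi> (And \<theta> (Neg \<theta>)) \<in> F"
      unfolding U_def by blast
    have l: "\<chi> \<in> L" using deductive_L[OF dI \<chi>(1)] .
    have "Neg \<chi> \<in> F"
      by (rule deductive_taut1[OF dF \<chi>(2)]) (use l in auto)
    \<comment> \<open>T and Five turn \<open>Neg \<chi>\<close> into
      \<open>BoxI (Neg (BoxI \<chi>))\<close> inside \<open>F\<close>, so that a \<open>BoxI\<close>
      stands under \<open>BoxF\<close> in \<open>\<Gamma>\<close> and Comm applies.\<close>
    have t: "D_PLC A V (Imp (BoxI \<chi>) \<chi>)"
      using l by (intro PLC_ax T) auto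
    have "D_PLC A V (Imp (Imp (BoxI \<chi>) \<chi>) (Imp (Neg \<chi>) (Neg (BoxI \<chi>))))"
      using l by (intro D_PLC_taut) (auto simp: tautology_def)
    then have "D_PLC A V (Imp (Neg \<chi>) (Neg (BoxI \<chi>)))" using t MP by blast
    then have "Neg (BoxI \<chi>) \<in> F"
      using \<open>Neg \<chi> \<in> F\<close> deductive_thm[OF dF] deductive_MP[OF dF] by blast
    moreover have "D_PLC A V (Imp (Neg (BoxI \<chi>)) (BoxI (Neg (BoxI \<chi>))))"
      using l by (intro PLC_ax Five) auto
    ultimately have "BoxI (Neg (BoxI \<chi>)) \<in> F"
      using deductive_thm[OF dF] deductive_MP[OF dF] by blast
    then have "BoxF (BoxI (Neg (BoxI \<chi>))) \<in> \<Gamma>" by (simp add: F_def)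
    \<comment> \<open>Comm brings \<open>BoxI\<close> to the front. The formula then travels to
      \<open>\<Gamma>'\<close> and on to \<open>\<Delta>'\<close>, where it denies
      \<open>BoxI \<chi>\<close>.\<close>
    moreover have "Iff (BoxF (BoxI (Neg (BoxI \<chi>)))) (BoxI (BoxF (Neg (BoxI \<chi>)))) \<in> \<Gamma>"
      using l by (intro deductive_thm[OF maximal_deductive[OF M(1)]] PLC_ax Comm) auto
    ultimately have "BoxI (BoxF (Neg (BoxI \<chi>))) \<in> \<Gamma>"
      using deductive_MP[OF maximal_deductive[OF M(1)]] maximal_And[OF M(1)] by blast
    then have "BoxF (Neg (BoxI \<chi>)) \<in> \<Gamma>'"
      using accD[OF M(1,2) _ acc(1)] by simp
    then have "Neg (BoxI \<chi>) \<in> \<Delta>'"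
      using accD[OF M(2,3) _ acc(2)] by simp
    moreover have "BoxI \<chi> \<in> \<Delta>'" using \<chi> by (simp add: I_def)
    ultimately show False using maximal_Neg[OF M(3), of "BoxI \<chi>"] l by simp
  qed
  then obtain \<Delta> where \<Delta>: "maximal \<Delta>" "U \<subseteq> \<Delta>"
    using lindenbaum[OF dU] \<theta> by force
  have "F \<subseteq> U"
  proof
    fix \<psi> assume \<psi>: "\<psi> \<in> F"
    have l: "\<psi> \<in> L" using deductive_L[OF dF \<psi>] .
    have "Imp (Top A V) \<psi> \<in> F"
      by (rule deductive_taut1[OF dF \<psi>]) (use l Top_L in auto)
    moreover have "Top A V \<in> I"
      using Top_L by (intro deductive_thm[OF dI] D_PLC_taut)
        (auto simp: tautology_def Top_def Let_def)
    ultimately show "\<psi> \<in> U" unfolding U_def by blast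
  qed
  moreover have "I \<subseteq> U"
  proof
    fix \<psi> assume \<psi>: "\<psi> \<in> I"
    have "Imp \<psi> \<psi> \<in> F"
      using deductive_L[OF dI \<psi>]
      by (intro deductive_thm[OF dF] D_PLC_taut) (auto simp: tautology_def)
    then show "\<psi> \<in> U" using \<psi> unfolding U_def by blast
  qed
  ultimately have "acc BoxF \<Gamma> \<Delta>" "acc BoxI \<Delta>' \<Delta>"
    using M \<Delta> by (auto intro!: accI simp: F_def I_def)
  then show ?thesis using \<Delta> acc_sym by blast
qed

section \<open>Atoms and decisions along the accessibility relations\<close>

lemma acc_state:
  assumes M: "maximal \<Gamma>" "maximal \<Delta>" and acc: "acc BoxF \<Gamma> \<Delta>"
  shows "state \<Gamma> = state \<Delta>"
proof -
  have "Atom p \<in> \<Gamma> \<longleftrightarrow> Atom p \<in> \<Delta>" if p: "p \<in> A" for p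
  proof -
    \<comment> \<open>Indep for the atom carries its presence to \<open>\<Delta>\<close>, Indep for
      the negation carries its absence.\<close>
    have "D_PLC A V (Imp (Atom p) (BoxF (Atom p)))"
      using p by (intro PLC_ax Indep_pos) auto
    moreover have "D_PLC A V (Imp (Neg (Atom p)) (BoxF (Neg (Atom p))))"
      using p by (intro PLC_ax Indep_neg) auto
    ultimately show ?thesis
      using maximal_rule[OF M(1)] accD[OF M _ acc] maximal_Neg[OF M(1), of "Atom p"]
        maximal_Neg[OF M(2), of "Atom p"] p by auto
  qed
  then show ?thesis by (auto simp: state_def)
qed

text \<open>AtLeast gives existence, AtMost uniqueness.\<close>

lemma maximal_Dec_ex1:
  assumes "maximal \<Gamma>"
  shows "\<exists>!x. Dec x \<in> \<Gamma>"
proof -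
  have "BigOr A V Dec V \<in> \<Gamma>"
    using finite_V
    by (intro deductive_thm[OF maximal_deductive[OF assms]] PLC_ax AtLeast BigOr_L) auto
  then obtain x where x: "x \<in> V" "Dec x \<in> \<Gamma>"
    using maximal_BigOr[OF assms finite_V, of Dec] by auto
  moreover have "x = y" if y: "Dec y \<in> \<Gamma>" for y
  proof (rule ccontr)
    assume "x \<noteq> y"
    have l: "y \<in> V" using deductive_L[OF maximal_deductive[OF assms] y] by simp
    then have "D_PLC A V (Imp (Dec x) (Neg (Dec y)))"
      using x \<open>x \<noteq> y\<close> by (intro PLC_ax AtMost) auto
    then show False
      using maximal_rule[OF assms] x y maximal_Neg[OF assms, of "Dec y"] l by auto
  qed
  ultimately show ?thesis by blast
qed

text \<open>Both sets contain the complete description of their common state, so the implication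
  that Funct puts under \<open>BoxI\<close> fires in \<open>\<Delta>\<close>.\<close>

lemma acc_Dec:
  assumes M: "maximal \<Gamma>" "maximal \<Delta>" and acc: "acc BoxI \<Gamma> \<Delta>"
    and st: "state \<Gamma> = state \<Delta>" and x: "Dec x \<in> \<Gamma>"
  shows "Dec x \<in> \<Delta>"
proof -
  let ?c = "cn A V (state \<Gamma>) A"
  have X: "state \<Gamma> \<subseteq> A" by (auto simp: state_def)
  have "x \<in> V" using deductive_L[OF maximal_deductive[OF M(1)] x] by simp
  then have "D_PLC A V (Imp (And ?c (Dec x)) (BoxI (Imp ?c (Dec x))))"
    using X cn_L[OF X] by (intro PLC_ax Funct) auto
  then have "BoxI (Imp ?c (Dec x)) \<in> \<Gamma>"
    using maximal_rule[OF M(1)] x maximal_And[OF M(1)] maximal_cn[OF M(1) X] by blast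
  then have "Imp ?c (Dec x) \<in> \<Delta>" using accD[OF M _ acc] by blast
  then show ?thesis
    using deductive_MP[OF maximal_deductive[OF M(2)]] maximal_cn[OF M(2) X] st by metis
qed

section \<open>Components and the models they yield\<close>

definition component :: "('a, 'v) fml set \<Rightarrow> ('a, 'v) fml set set" where
  "component \<Gamma> = {\<Theta>. maximal \<Theta> \<and> (\<exists>\<Delta>. maximal \<Delta> \<and> acc BoxF \<Gamma> \<Delta> \<and> acc BoxI \<Delta> \<Theta>)}"

lemma component_maximal: "\<Theta> \<in> component \<Gamma> \<Longrightarrow> maximal \<Theta>"
  by (simp add: component_def)

lemma component_self: "maximal \<Gamma> \<Longrightarrow> \<Gamma> \<in> component \<Gamma>"
  using acc_refl by (auto simp: component_def)

lemma component_accI: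
  "\<Theta> \<in> component \<Gamma> \<Longrightarrow> maximal \<Delta> \<Longrightarrow> acc BoxI \<Theta> \<Delta> \<Longrightarrow> \<Delta> \<in> component \<Gamma>"
  using acc_trans by (fastforce simp: component_def)

text \<open>A member is reached by a \<open>BoxF\<close> step and then a \<open>BoxI\<close> step.
  \<open>acc_commute\<close> moves a further \<open>BoxF\<close> step in front of the
  \<open>BoxI\<close> step, where it merges with the first one.\<close>

lemma component_accF:
  assumes "\<Theta> \<in> component \<Gamma>" "maximal \<Delta>" "acc BoxF \<Theta> \<Delta>"
  shows "\<Delta> \<in> component \<Gamma>"
proof -
  obtain \<Xi> where \<Xi>: "maximal \<Xi>" "acc BoxF \<Gamma> \<Xi>" "acc BoxI \<Xi> \<Theta>"
    using assms(1) by (auto simp: component_def)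
  then obtain \<Xi>' where "maximal \<Xi>'" "acc BoxF \<Xi> \<Xi>'" "acc BoxI \<Xi>' \<Delta>"
    using acc_commute component_maximal[OF assms(1)] assms(2,3) by blast
  then show ?thesis
    using assms(2) acc_trans[OF \<Xi>(2)] by (auto simp: component_def)
qed

text \<open>Going back from \<open>\<Theta>\<close> along \<open>BoxI\<close> and then across
  through \<open>\<Gamma>\<close> along \<open>BoxF\<close> gives a path that
  \<open>acc_commute\<close> turns around. So every \<open>BoxI\<close> class of the component meets
  every \<open>BoxF\<close> class.\<close>

lemma component_linked:
  assumes "\<Theta> \<in> component \<Gamma>" "\<Theta>' \<in> component \<Gamma>"
  shows "\<exists>\<Delta>. maximal \<Delta> \<and> acc BoxF \<Theta> \<Delta> \<and> acc BoxI \<Delta> \<Theta>'"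
proof -
  obtain \<Xi> \<Xi>' where \<Xi>: "maximal \<Xi>" "acc BoxF \<Gamma> \<Xi>" "acc BoxI \<Xi> \<Theta>"
    "maximal \<Xi>'" "acc BoxF \<Gamma> \<Xi>'" "acc BoxI \<Xi>' \<Theta>'"
    using assms by (auto simp: component_def)
  have "acc BoxI \<Theta> \<Xi>" "acc BoxF \<Xi> \<Xi>'"
    using \<Xi> acc_sym acc_trans by blast+
  then obtain \<Delta> where "maximal \<Delta>" "acc BoxF \<Theta> \<Delta>" "acc BoxI \<Delta> \<Xi>'"
    using acc_commute component_maximal[OF assms(1)] \<Xi> by blast
  then show ?thesis using \<Xi> acc_trans by blast
qed

text \<open>For \<open>\<Gamma>\<close> in a component \<open>W\<close>, exactly one value meets the
  description, by \<open>component_state\<close>, \<open>maximal_Dec_ex1\<close> and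
  \<open>acc_Dec\<close>. Arguments that are not states of \<open>W\<close> go to
  \<open>undefined\<close>, as the extensional function space demands.\<close>

definition classifier :: "('a, 'v) fml set set \<Rightarrow> ('a, 'v) fml set \<Rightarrow> 'a set \<Rightarrow> 'v" where
  "classifier W \<Gamma> = (\<lambda>s\<in>state ` W.
     THE x. \<exists>\<Delta>. maximal \<Delta> \<and> acc BoxI \<Gamma> \<Delta> \<and> state \<Delta> = s \<and> Dec x \<in> \<Delta>)"

lemma classifier_cong:
  assumes "acc BoxI \<Gamma> \<Delta>"
  shows "classifier W \<Gamma> = classifier W \<Delta>"
proof -
  have "acc BoxI \<Gamma> = acc BoxI \<Delta>" using assms by (auto simp: acc_def fun_eq_iff)
  then show ?thesis by (simp add: classifier_def)
qed

text \<open>By \<open>acc_Dec\<close> all members of the \<open>BoxI\<close> class with this state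
  share their decision atom, so the description reduces to the decision in \<open>\<Gamma>\<close>
  itself.\<close>

lemma classifier_state:
  assumes "maximal \<Gamma>" "\<Gamma> \<in> W"
  shows "classifier W \<Gamma> (state \<Gamma>) = x \<longleftrightarrow> Dec x \<in> \<Gamma>"
proof -
  have "(\<exists>\<Delta>. maximal \<Delta> \<and> acc BoxI \<Gamma> \<Delta> \<and> state \<Delta> = state \<Gamma> \<and> Dec y \<in> \<Delta>) \<longleftrightarrow> Dec y \<in> \<Gamma>" for y
    using assms(1) acc_Dec[of _ \<Gamma>] acc_sym acc_refl by blast
  then have "classifier W \<Gamma> (state \<Gamma>) = (THE y. Dec y \<in> \<Gamma>)"
    using assms(2) by (simp add: classifier_def)
  then show ?thesis
    using theI'[OF maximal_Dec_ex1[OF assms(1)]] maximal_Dec_ex1[OF assms(1)] by metis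
qed

text \<open>Any \<open>\<Theta>'\<close> with state \<open>s\<close> has a \<open>BoxF\<close>
  successor in the \<open>BoxI\<close> class of \<open>\<Theta>\<close>, and by Indep that step
  keeps the state. Hence a classifier finds a decision at every state of the model.\<close>

lemma component_state:
  assumes "\<Theta> \<in> component \<Gamma>" "s \<in> state ` component \<Gamma>"
  obtains \<Delta> where "\<Delta> \<in> component \<Gamma>" "acc BoxI \<Theta> \<Delta>" "state \<Delta> = s"
proof -
  obtain \<Theta>' where \<Theta>': "\<Theta>' \<in> component \<Gamma>" "s = state \<Theta>'" using assms(2) by blast
  then obtain \<Delta> where \<Delta>: "maximal \<Delta>" "acc BoxF \<Theta>' \<Delta>" "acc BoxI \<Delta> \<Theta>"
    using component_linked assms(1) by blast
  then have "state \<Delta> = s" using acc_state component_maximal \<Theta>' by blast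
  then show ?thesis using that component_accF[OF \<Theta>'(1) \<Delta>(1,2)] acc_sym[OF \<Delta>(3)] by blast
qed

text \<open>A \<open>BoxI\<close> step keeps the classifier and a \<open>BoxF\<close> step keeps the
  state, which is the forth condition of a bounded morphism. The back conditions are
  \<open>component_state\<close> and \<open>component_linked\<close>.\<close>

lemma truth:
  assumes "static \<phi>" "\<phi> \<in> L" "\<Theta> \<in> component \<Gamma>"
  defines "W \<equiv> component \<Gamma>"
  shows "sat (state ` W) (classifier W ` W) (state \<Theta>) (classifier W \<Theta>) \<phi> \<longleftrightarrow> \<phi> \<in> \<Theta>"
  using assms(1-3)
proof (induction \<phi> arbitrary: \<Theta>)
  case (Atom p)
  then show ?case by (simp add: state_def)
next
  case (Dec x)
  then show ?case using classifier_state component_maximal by (simp add: W_def)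
next
  case (Neg \<phi>)
  then show ?case using maximal_Neg component_maximal by auto
next
  case (And \<phi> \<psi>)
  then show ?case using maximal_And component_maximal by auto
next
  case (BoxI \<phi>)
  let ?sat = "sat (state ` W) (classifier W ` W)"
  have \<Theta>: "maximal \<Theta>" using BoxI component_maximal by blast
  have eq: "?sat (state \<Delta>) (classifier W \<Theta>) \<phi> \<longleftrightarrow> \<phi> \<in> \<Delta>" if "\<Delta> \<in> W" "acc BoxI \<Theta> \<Delta>" for \<Delta>
    using BoxI that classifier_cong[OF that(2)] by (simp add: W_def)
  \<comment> \<open>Every state of the model occurs in the \<open>BoxI\<close> class of
    \<open>\<Theta>\<close>, so the quantifier may be confined to that class.\<close>
  have "(\<forall>s\<in>state ` W. ?sat s (classifier W \<Theta>) \<phi>) \<longleftrightarrow> (\<forall>\<Delta>\<in>W. acc BoxI \<Theta> \<Delta> \<longrightarrow> \<phi> \<in> \<Delta>)"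
    using eq component_state[OF BoxI.prems(3)] unfolding W_def by (metis imageI)
  \<comment> \<open>Accessible maximal sets stay in the component, so \<open>maximal_box\<close> may
    be read inside \<open>W\<close>.\<close>
  also have "\<dots> \<longleftrightarrow> BoxI \<phi> \<in> \<Theta>"
    using maximal_box[OF \<Theta>, of BoxI \<phi>] BoxI.prems component_accI[OF BoxI.prems(3)]
      component_maximal unfolding W_def by simp blast
  finally show ?case by simp
next
  case (BoxF \<phi>)
  let ?sat = "sat (state ` W) (classifier W ` W)"
  have \<Theta>: "maximal \<Theta>" using BoxF component_maximal by blast
  have eq: "?sat (state \<Theta>) (classifier W \<Delta>) \<phi> \<longleftrightarrow> \<phi> \<in> \<Delta>" if "\<Delta> \<in> W" "acc BoxF \<Theta> \<Delta>" for \<Delta>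
    using BoxF that acc_state[OF \<Theta> _ that(2)] component_maximal by (simp add: W_def)
  \<comment> \<open>Every function of the model is already the classifier of a \<open>BoxF\<close>
    successor of \<open>\<Theta>\<close>.\<close>
  have link: "\<exists>\<Delta>\<in>W. acc BoxF \<Theta> \<Delta> \<and> classifier W \<Delta> = classifier W \<Xi>" if "\<Xi> \<in> W" for \<Xi>
    using component_linked[OF BoxF.prems(3)] component_accF[OF BoxF.prems(3)] classifier_cong that
    unfolding W_def by metis
  have "(\<forall>f\<in>classifier W ` W. ?sat (state \<Theta>) f \<phi>) \<longleftrightarrow> (\<forall>\<Delta>\<in>W. acc BoxF \<Theta> \<Delta> \<longrightarrow> \<phi> \<in> \<Delta>)"
  proof (intro iffI ballI impI)
    fix \<Delta> assume "\<forall>f\<in>classifier W ` W. ?sat (state \<Theta>) f \<phi>" "\<Delta> \<in> W" "acc BoxF \<Theta> \<Delta>"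
    then show "\<phi> \<in> \<Delta>" using eq by blast
  next
    fix f assume *: "\<forall>\<Delta>\<in>W. acc BoxF \<Theta> \<Delta> \<longrightarrow> \<phi> \<in> \<Delta>" "f \<in> classifier W ` W"
    then obtain \<Delta> where "\<Delta> \<in> W" "acc BoxF \<Theta> \<Delta>" "f = classifier W \<Delta>"
      using link by (metis imageE)
    then show "?sat (state \<Theta>) f \<phi>" using eq * by blast
  qed
  also have "\<dots> \<longleftrightarrow> BoxF \<phi> \<in> \<Theta>"
    using maximal_box[OF \<Theta>, of BoxF \<phi>] BoxF.prems component_accF[OF BoxF.prems(3)]
      component_maximal unfolding W_def by simp blast
  finally show ?case by simp
qed auto

lemma component_MCM:
  fixes \<Gamma>
  defines "W \<equiv> component \<Gamma>"
  shows "MCM A V (state ` W) (classifier W ` W)"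
proof -
  have "classifier W \<Theta> \<in> state ` W \<rightarrow>\<^sub>E V" if \<Theta>: "\<Theta> \<in> W" for \<Theta>
  proof (rule PiE_I)
    fix s assume "s \<in> state ` W"
    then obtain \<Delta> where \<Delta>: "\<Delta> \<in> W" "acc BoxI \<Theta> \<Delta>" "state \<Delta> = s"
      using component_state \<Theta> unfolding W_def by blast
    have m: "maximal \<Delta>" using \<Delta> component_maximal by (simp add: W_def)
    \<comment> \<open>The value at \<open>s\<close> is the decision in some \<open>\<Delta>\<close>
      of the \<open>BoxI\<close> class with state \<open>s\<close>; decision atoms in
      \<open>L\<close> are indexed by \<open>V\<close>.\<close>
    have "Dec (classifier W \<Theta> s) \<in> \<Delta>"
      using classifier_state[OF m \<Delta>(1)] classifier_cong[OF \<Delta>(2)] \<Delta>(3) by metis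
    then show "classifier W \<Theta> s \<in> V"
      using deductive_L[OF maximal_deductive[OF m]] by fastforce
  qed (simp add: classifier_def)
  then show ?thesis by (auto simp: MCM_def state_def)
qed

lemma static_completeness:
  assumes "static \<phi>" "\<phi> \<in> L" "valid A V \<phi>"
  shows "D_PLC A V \<phi>"
proof (rule ccontr)
  assume "\<not> D_PLC A V \<phi>"
  \<comment> \<open>The theorems form the least deductive set, and Lindenbaum's lemma is applied to
    it.\<close>
  moreover have "deductive {\<psi>. D_PLC A V \<psi>}"
    using D_PLC_Ldyn MP unfolding deductive_def by blast
  ultimately obtain \<Gamma> where \<Gamma>: "maximal \<Gamma>" "\<phi> \<notin> \<Gamma>"
    using lindenbaum assms(2) by blast
  then show False
    using truth[OF assms(1,2) component_self[OF \<Gamma>(1)]] component_MCM assms(3)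
      component_self[OF \<Gamma>(1)] unfolding valid_def by blast
qed

end

theorem theorem8:
  fixes Atm0 :: "'a set" and Val :: "'v set" and \<phi> :: "('a, 'v) fml"
  assumes "finite Atm0" and "finite Val" and "\<phi> \<in> Ldyn Atm0 Val"
  shows "D_PLC Atm0 Val \<phi> \<longleftrightarrow> valid Atm0 Val \<phi>"
proof
  assume "D_PLC Atm0 Val \<phi>"
  then show "valid Atm0 Val \<phi>" using soundness assms by blast
next
  assume valid: "valid Atm0 Val \<phi>"
  \<comment> \<open>The formula \<open>\<phi>\<close> itself shows that the language is
    nonempty.\<close>
  interpret language Atm0 Val using assms by unfold_locales auto
  obtain \<chi> where \<chi>: "static \<chi>" "D_PLC Atm0 Val (Iff \<phi> \<chi>)"
    using static_equivalent assms(3) by blast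
  \<comment> \<open>Soundness serves completeness too: it transfers validity from
    \<open>\<phi>\<close> to its static equivalent.\<close>
  have "valid Atm0 Val (Iff \<phi> \<chi>)" using soundness \<chi>(2) assms by blast
  then have "valid Atm0 Val \<chi>" using valid by (simp add: valid_def)
  then have "D_PLC Atm0 Val \<chi>"
    using static_completeness \<chi> D_PLC_Ldyn[OF \<chi>(2)] by simp
  then show "D_PLC Atm0 Val \<phi>" using \<chi>(2) D_PLC_Iff_left by blast
qed

end
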